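(* Let $\Gamma$ be a metrized graph, $p,q\in\Gamma$, and $n>-1$ a real number. Then $$\int_\Gamma\Big(\frac{d}{dx}j_p(x,q)\Big)^2 j_p(x,q)^n\,dx=\frac{1}{n+1}\,r(p,q)^{n+1}.$$
   Context: A metrized graph is a finite connected graph (multiple edges and self-loops allowed) in which each edge is identified with a closed interval of positive length; $dx$ is arclength and $d/dx$ differentiation along edges. Regard it as a resistive circuit with segment resistance equal to length; $j_z(x,y)$ is the potential at $x$ when unit current enters at $y$ and exits at $z$, with potential $0$ at $z$; $r(x,y)$ is the effective resistance between $x$ and $y$. *)

theory Defs
  imports "HOL-Analysis.Analysis" "Graph_Theory.Digraph_Component"
begin

text \<open>
  Combinatorial data of a metrized graph: a finite multigraph (loops and parallel edges allowed)
  with an edge length function. The direction of an arc only fixes a parametrization of the edge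
  \<open>e\<close> by the interval from \<open>0\<close> (at its tail) to \<open>len e\<close> (at its head); connectedness refers to
  the underlying undirected graph.
\<close>

locale metrized_graph = fin_digraph G
  for G :: "('v, 'e) pre_digraph" +
  fixes len :: "'e \<Rightarrow> real"
  assumes connected_graph: "Digraph_Component.connected G"
    and len_pos: "e \<in> arcs G \<Longrightarrow> 0 < len e"

text \<open>
  The space \<open>\<Gamma>\<close> is the quotient of the disjoint union of the closed edges obtained by gluing
  end points at common vertices. Each class has a unique representative: a vertex, or a point in
  the interior of an edge given by its arclength parameter.
\<close>

datatype ('v, 'e) gpoint = Vertex 'v | Inner 'e real

definition points :: "('v, 'e) pre_digraph \<Rightarrow> ('e \<Rightarrow> real) \<Rightarrow> ('v, 'e) gpoint set" where
  "points G len = Vertex ` verts G \<union> {Inner e t | e t. e \<in> arcs G \<and> 0 < t \<and> t < len e}"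

definition edge_point ::
  "('v, 'e) pre_digraph \<Rightarrow> ('e \<Rightarrow> real) \<Rightarrow> 'e \<Rightarrow> real \<Rightarrow> ('v, 'e) gpoint" where
  "edge_point G len e t =
     (if t = 0 then Vertex (tail G e) else if t = len e then Vertex (head G e) else Inner e t)"

text \<open>
  A function given almost everywhere: at the vertices, where differentiation along an edge makes
  no sense, the value is set to \<open>0\<close>. Reversing an edge changes the sign of the derivative on it.
\<close>

fun edge_deriv ::
  "('v, 'e) pre_digraph \<Rightarrow> ('e \<Rightarrow> real) \<Rightarrow> (('v, 'e) gpoint \<Rightarrow> real) \<Rightarrow> ('v, 'e) gpoint \<Rightarrow> real"
where
  "edge_deriv G len f (Vertex v) = 0"
| "edge_deriv G len f (Inner e t) = deriv (\<lambda>s. f (edge_point G len e s)) t"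

definition graph_integrable ::
  "('v, 'e) pre_digraph \<Rightarrow> ('e \<Rightarrow> real) \<Rightarrow> (('v, 'e) gpoint \<Rightarrow> real) \<Rightarrow> bool" where
  "graph_integrable G len g \<longleftrightarrow>
     (\<forall>e\<in>arcs G. set_integrable lborel {0..len e} (\<lambda>t. g (edge_point G len e t)))"

definition graph_integral ::
  "('v, 'e) pre_digraph \<Rightarrow> ('e \<Rightarrow> real) \<Rightarrow> (('v, 'e) gpoint \<Rightarrow> real) \<Rightarrow> real" where
  "graph_integral G len g = (\<Sum>e\<in>arcs G. LBINT t:{0..len e}. g (edge_point G len e t))"

text \<open>
  Tangent directions at \<open>x\<close>: \<open>(e, t, s)\<close> leaves the point with parameter \<open>t\<close> of the edge \<open>e\<close>
  towards the head (\<open>s = 1\<close>) or the tail (\<open>s = -1\<close>). There are two directions at an interior point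
  of an edge, and a loop contributes two directions at its vertex.
\<close>

definition directions ::
  "('v, 'e) pre_digraph \<Rightarrow> ('e \<Rightarrow> real) \<Rightarrow> ('v, 'e) gpoint \<Rightarrow> ('e \<times> real \<times> real) set" where
  "directions G len x =
     {(e, t, s). e \<in> arcs G \<and> 0 \<le> t \<and> t \<le> len e \<and> edge_point G len e t = x \<and>
        (s = 1 \<and> t < len e \<or> s = -1 \<and> 0 < t)}"

definition slope ::
  "('v, 'e) pre_digraph \<Rightarrow> ('e \<Rightarrow> real) \<Rightarrow> (('v, 'e) gpoint \<Rightarrow> real) \<Rightarrow> 'e \<times> real \<times> real \<Rightarrow> real"
where
  "slope G len f = (\<lambda>(e, t, s).
     Lim (at_right 0) (\<lambda>h. (f (edge_point G len e (t + s * h)) - f (edge_point G len e t)) / h))"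

text \<open>The pieces are closed segments, so continuity along the edges is included.\<close>

definition piecewise_affine ::
  "('v, 'e) pre_digraph \<Rightarrow> ('e \<Rightarrow> real) \<Rightarrow> (('v, 'e) gpoint \<Rightarrow> real) \<Rightarrow> bool" where
  "piecewise_affine G len f \<longleftrightarrow>
     (\<forall>e\<in>arcs G. \<exists>S. finite S \<and>
        (\<forall>a b. 0 \<le> a \<and> a \<le> b \<and> b \<le> len e \<and> {a<..<b} \<inter> S = {} \<longrightarrow>
           (\<exists>c m. \<forall>t\<in>{a..b}. f (edge_point G len e t) = c + m * t)))"

text \<open>
  Potentials in the circuit when unit current enters at \<open>y\<close> and exits at \<open>z\<close>. Resistance equals
  length, so by Ohm's law the potential is affine on segments carrying a constant current, and the
  current leaving a point in a given direction is minus the slope in that direction.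
  Kirchhoff's current law requires the total current leaving \<open>x\<close> along the graph to be \<open>1\<close> at
  \<open>y\<close>, \<open>-1\<close> at \<open>z\<close> and \<open>0\<close> elsewhere (and \<open>0\<close> everywhere if \<open>y = z\<close>).
\<close>

definition unit_current_potential ::
  "('v, 'e) pre_digraph \<Rightarrow> ('e \<Rightarrow> real) \<Rightarrow> ('v, 'e) gpoint \<Rightarrow> ('v, 'e) gpoint \<Rightarrow>
     (('v, 'e) gpoint \<Rightarrow> real) \<Rightarrow> bool" where
  "unit_current_potential G len y z f \<longleftrightarrow>
     piecewise_affine G len f \<and>
     (\<forall>x\<in>points G len. (\<Sum>d\<in>directions G len x. - slope G len f d) = of_bool (x = y) - of_bool (x = z))"

text \<open>
  \<open>potential_j G len z x y\<close> is \<open>j\<^sub>z(x, y)\<close>. Membership in \<open>extensional\<close> pins down the irrelevant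
  values outside \<open>\<Gamma>\<close>, so that the function is unique.
\<close>

definition potential_j ::
  "('v, 'e) pre_digraph \<Rightarrow> ('e \<Rightarrow> real) \<Rightarrow> ('v, 'e) gpoint \<Rightarrow> ('v, 'e) gpoint \<Rightarrow>
     ('v, 'e) gpoint \<Rightarrow> real" where
  "potential_j G len z x y =
     (THE f. f \<in> extensional (points G len) \<and> unit_current_potential G len y z f \<and> f z = 0) x"

text \<open>The potential difference between \<open>x\<close> and \<open>y\<close> that drives a unit current from \<open>x\<close> to \<open>y\<close>.\<close>

definition eff_resistance ::
  "('v, 'e) pre_digraph \<Rightarrow> ('e \<Rightarrow> real) \<Rightarrow> ('v, 'e) gpoint \<Rightarrow> ('v, 'e) gpoint \<Rightarrow> real" where
  "eff_resistance G len x y = potential_j G len y x x - potential_j G len y y x"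

end

theory Submission
  imports Defs
begin

text \<open>
  Write \<open>f\<close> for \<open>j\<^sub>p(x, q)\<close>. On every affine piece of \<open>f\<close> with slope \<open>m\<close>, the integral of
  \<open>f' (\<Phi> \<circ> f)'\<close> is \<open>m\<close> times the increment of \<open>\<Phi> \<circ> f\<close>. Summing over all pieces and regrouping by
  end points, Kirchhoff's law leaves only \<open>\<Phi> (f q) - \<Phi> (f p)\<close>. With \<open>\<Phi> y = y\<^bsup>n+1\<^esup> / (n + 1)\<close> this is
  the claimed identity. The same identity for monotone \<open>\<Phi>\<close>, where all contributions are
  nonnegative, yields uniqueness of potentials (\<open>\<Phi>\<close> the identity) and \<open>f \<ge> 0\<close>
  (\<open>\<Phi> y = min y 0\<close>). Finally \<open>j\<^sub>q(x, p) = f q - f x\<close> by uniqueness, so \<open>r(p, q) = f q\<close>.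
\<close>

section \<open>Solvability of Kirchhoff's equations on a finite weighted network\<close>

text \<open>
  Edges are added one at a time. If the new edge \<open>k\<close> closes a cycle, the potential is corrected by
  a multiple of the unit current potential \<open>h\<close> between the ends of \<open>k\<close>; if \<open>k\<close> joins two
  components, it is corrected by a function \<open>\<phi>\<close> constant on components.
\<close>

lemma network_potential_exists:
  fixes src tgt :: "'e \<Rightarrow> 'v" and c :: "'e \<Rightarrow> real" and b :: "'v \<Rightarrow> real"
  assumes "finite K" and N: "finite N"
    and "\<And>e. e \<in> K \<Longrightarrow> src e \<in> N \<and> tgt e \<in> N \<and> c e > 0"
    and "\<And>\<phi>. (\<And>e. e \<in> K \<Longrightarrow> \<phi> (src e) = \<phi> (tgt e)) \<Longrightarrow> (\<Sum>x\<in>N. b x * \<phi> x) = 0"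
  shows "\<exists>g. \<forall>x\<in>N.
    (\<Sum>e\<in>K. c e * (g (src e) - g (tgt e)) * (of_bool (src e = x) - of_bool (tgt e = x))) = b x"
  using assms(1,3,4)
proof (induction K arbitrary: b rule: finite_induct)
  case empty
  \<comment> \<open>Without edges every test function is admissible, in particular the indicator of
    \<open>x\<close>.\<close>
  have "b x = 0" if "x \<in> N" for x
    using empty(2)[of "\<lambda>y. of_bool (y = x)"] that N by (simp add: of_bool_def if_distrib cong: if_cong)
  then show ?case by simp
next
  case (insert k K)
  define L where "L F g x =
    (\<Sum>e\<in>F. c e * (g (src e) - g (tgt e)) * (of_bool (src e = x) - of_bool (tgt e = x)))"
    for F and g :: "'v \<Rightarrow> real" and x
  define d where "d x = (of_bool (src k = x) - of_bool (tgt k = x) :: real)" for x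
  have K: "src e \<in> N" "tgt e \<in> N" "c e > 0" if "e \<in> K" for e using insert.prems(1) that by auto
  have k: "src k \<in> N" "tgt k \<in> N" "c k > 0" using insert.prems(1) by auto
  \<comment> \<open>Discrete integration by parts: it turns sums over nodes into sums over
    edges.\<close>
  have pair: "(\<Sum>x\<in>N. (of_bool (src e = x) - of_bool (tgt e = x)) * \<phi> x) = \<phi> (src e) - \<phi> (tgt e)"
    if "src e \<in> N" "tgt e \<in> N" for e and \<phi> :: "'v \<Rightarrow> real"
  proof -
    have "(\<Sum>x\<in>N. of_bool (y = x) * \<phi> x) = \<phi> y" if "y \<in> N" for y
      using that N by (subst sum.mono_neutral_right[of N "{y}"]) auto
    then show ?thesis using that by (simp add: left_diff_distrib sum_subtractf)
  qed
  have L_insert: "L (insert k K) g x = c k * (g (src k) - g (tgt k)) * d x + L K g x" for g x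
    using insert.hyps by (simp add: L_def d_def)
  have L_add: "L K (\<lambda>x. g x + s * h x) x = L K g x + s * L K h x" for g h s x
    unfolding L_def sum_distrib_left sum.distrib[symmetric]
    by (rule sum.cong) (auto simp: algebra_simps)
  have IH: "\<exists>g. \<forall>x\<in>N. L K g x = b' x"
    if "\<And>\<phi>. (\<And>e. e \<in> K \<Longrightarrow> \<phi> (src e) = \<phi> (tgt e)) \<Longrightarrow> (\<Sum>x\<in>N. b' x * \<phi> x) = 0" for b'
    using insert.IH[of b'] that insert.prems(1) unfolding L_def by simp
  have "\<exists>g. \<forall>x\<in>N. L (insert k K) g x = b x"
  proof (cases "\<exists>\<phi>::'v \<Rightarrow> real. (\<forall>e\<in>K. \<phi> (src e) = \<phi> (tgt e)) \<and> \<phi> (src k) \<noteq> \<phi> (tgt k)")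
    case False
    \<comment> \<open>Functions constant along \<open>K\<close> now also agree at the ends of
      \<open>k\<close>, so the solvability condition for \<open>insert k K\<close> passes to
      \<open>K\<close>. For the same reason \<open>d\<close> satisfies it.\<close>
    then obtain f where f: "\<forall>x\<in>N. L K f x = b x"
      using IH[of b] insert.prems(2) by (metis insertE)
    obtain h where h: "\<forall>x\<in>N. L K h x = d x"
      using IH[of d] False unfolding d_def by (auto simp: pair k)
    \<comment> \<open>\<open>R\<close> is the effective resistance of \<open>K\<close> between the
      ends of \<open>k\<close>. It equals the energy of \<open>h\<close>, so it is nonnegative and
      the denominator of \<open>s\<close> cannot vanish.\<close>
    define R where "R = h (src k) - h (tgt k)"
    have "R = (\<Sum>x\<in>N. L K h x * h x)"
      using h pair[OF k(1,2), of h] by (simp add: R_def d_def)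
    also have "\<dots> = (\<Sum>e\<in>K. c e * (h (src e) - h (tgt e)) *
        (\<Sum>x\<in>N. (of_bool (src e = x) - of_bool (tgt e = x)) * h x))"
      unfolding L_def sum_distrib_right sum_distrib_left
      by (subst sum.swap) (simp add: mult.assoc)
    also have "\<dots> = (\<Sum>e\<in>K. c e * (h (src e) - h (tgt e))\<^sup>2)"
      by (rule sum.cong) (auto simp: pair K power2_eq_square)
    also have "\<dots> \<ge> 0" using K by (intro sum_nonneg) (simp add: less_imp_le)
    finally have "1 + c k * R > 0" using k(3) by (simp add: add_pos_nonneg)
    \<comment> \<open>\<open>s\<close> is the current through \<open>k\<close>, solved from Ohm's
      law for \<open>k\<close> applied to \<open>f - s * h\<close>; the term \<open>- s * h\<close>
      compensates this current inside \<open>K\<close>.\<close>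
    define s where "s = c k * (f (src k) - f (tgt k)) / (1 + c k * R)"
    have s: "c k * (f (src k) - f (tgt k) - s * R) = s"
      using \<open>1 + c k * R > 0\<close> by (simp add: s_def field_simps)
    have "\<forall>x\<in>N. L (insert k K) (\<lambda>x. f x + (- s) * h x) x = b x"
    proof
      fix x assume "x \<in> N"
      have "c k * ((f (src k) + - s * h (src k)) - (f (tgt k) + - s * h (tgt k))) = s"
        using s by (simp add: R_def algebra_simps)
      then show "L (insert k K) (\<lambda>x. f x + (- s) * h x) x = b x"
        unfolding L_insert L_add using f h \<open>x \<in> N\<close> by simp
    qed
    then show ?thesis by blast
  next
    case True
    then obtain \<phi>\<^sub>0 :: "'v \<Rightarrow> real" where \<phi>\<^sub>0: "\<forall>e\<in>K. \<phi>\<^sub>0 (src e) = \<phi>\<^sub>0 (tgt e)" "\<phi>\<^sub>0 (src k) \<noteq> \<phi>\<^sub>0 (tgt k)"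
      by blast
    \<comment> \<open>Normalized to drop by 1 across \<open>k\<close>, so that adding multiples of
      it adjusts the current in \<open>k\<close> and in no edge of \<open>K\<close>.\<close>
    define \<phi> where "\<phi> x = \<phi>\<^sub>0 x / (\<phi>\<^sub>0 (src k) - \<phi>\<^sub>0 (tgt k))" for x
    have \<phi>: "\<phi> (src e) = \<phi> (tgt e)" if "e \<in> K" for e using \<phi>\<^sub>0 that by (simp add: \<phi>_def)
    have \<phi>k: "\<phi> (src k) - \<phi> (tgt k) = 1"
      using \<phi>\<^sub>0(2) by (simp add: \<phi>_def diff_divide_distrib[symmetric])
    \<comment> \<open>No edge but \<open>k\<close> sees a change of \<open>\<phi>\<close>, so
      \<open>B\<close> is the current that \<open>k\<close> is forced to carry.\<close>
    define B where "B = (\<Sum>x\<in>N. b x * \<phi> x)"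
    have "(\<Sum>x\<in>N. (b x - B * d x) * \<psi> x) = 0" if \<psi>: "\<And>e. e \<in> K \<Longrightarrow> \<psi> (src e) = \<psi> (tgt e)" for \<psi>
    proof -
      define D where "D = \<psi> (src k) - \<psi> (tgt k)"
      \<comment> \<open>Subtracting \<open>D * \<phi>\<close> removes the jump of
        \<open>\<psi>\<close> across \<open>k\<close>, which makes it a test function for all of
        \<open>insert k K\<close>.\<close>
      have "(\<Sum>x\<in>N. b x * (\<psi> x - D * \<phi> x)) = 0"
      proof (rule insert.prems(2))
        fix e assume "e \<in> insert k K"
        moreover have "D * (\<phi> (src k) - \<phi> (tgt k)) = \<psi> (src k) - \<psi> (tgt k)"
          by (simp add: \<phi>k D_def)
        ultimately show "\<psi> (src e) - D * \<phi> (src e) = \<psi> (tgt e) - D * \<phi> (tgt e)"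
          using \<psi> \<phi> by (auto simp: algebra_simps)
      qed
      then have "(\<Sum>x\<in>N. b x * \<psi> x) = D * B"
        by (simp add: B_def sum_distrib_left right_diff_distrib sum_subtractf algebra_simps)
      moreover have "(\<Sum>x\<in>N. d x * \<psi> x) = D" unfolding d_def D_def by (rule pair[OF k(1,2)])
      ultimately show ?thesis
        by (simp add: left_diff_distrib sum_subtractf mult.assoc sum_distrib_left[symmetric])
    qed
    from IH[OF this] obtain f where f: "\<forall>x\<in>N. L K f x = b x - B * d x" by blast
    define s where "s = B / c k - (f (src k) - f (tgt k))"
    have "L K \<phi> x = 0" for x unfolding L_def by (rule sum.neutral) (simp add: \<phi>)
    moreover have "c k * ((f (src k) + s * \<phi> (src k)) - (f (tgt k) + s * \<phi> (tgt k))) = B"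
    proof -
      have "(f (src k) + s * \<phi> (src k)) - (f (tgt k) + s * \<phi> (tgt k))
          = (f (src k) - f (tgt k)) + s * (\<phi> (src k) - \<phi> (tgt k))" by (simp add: algebra_simps)
      then show ?thesis using k(3) by (simp add: \<phi>k s_def)
    qed
    ultimately have "\<forall>x\<in>N. L (insert k K) (\<lambda>x. f x + s * \<phi> x) x = b x"
      unfolding L_insert L_add using f by simp
    then show ?thesis by blast
  qed
  then show ?case unfolding L_def .
qed

section \<open>Piecewise affine functions on an interval\<close>

text \<open>Reduces claims about an interval to affine pieces and gluing. The induction is on the
  number of breakpoints strictly inside: cutting at one of them leaves fewer on either side.\<close>

lemma breakpoint_induct [consumes 2, case_names affine split]:
  fixes S :: "real set"
  assumes "finite S" and "a < b"
    and "\<And>u v. a \<le> u \<Longrightarrow> u < v \<Longrightarrow> v \<le> b \<Longrightarrow> {u<..<v} \<inter> S = {} \<Longrightarrow> P u v"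
    and "\<And>u s v. a \<le> u \<Longrightarrow> u < s \<Longrightarrow> s < v \<Longrightarrow> v \<le> b \<Longrightarrow> s \<in> S \<Longrightarrow> P u s \<Longrightarrow> P s v \<Longrightarrow> P u v"
  shows "P a b"
proof -
  have "P u v" if "a \<le> u" "u < v" "v \<le> b" for u v
    using that
  proof (induction "card (S \<inter> {u<..<v})" arbitrary: u v rule: less_induct)
    case less
    show ?case
    proof (cases "{u<..<v} \<inter> S = {}")
      case True
      then show ?thesis using assms(3) less by blast
    next
      case False
      then obtain s where s: "s \<in> S" "u < s" "s < v" by auto
      have "card (S \<inter> {u<..<s}) < card (S \<inter> {u<..<v})" "card (S \<inter> {s<..<v}) < card (S \<inter> {u<..<v})"
        using s assms(1) by (auto intro!: psubset_card_mono)
      then have "P u s" "P s v" using less s by auto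
      then show ?thesis using assms(4) s less by blast
    qed
  qed
  then show ?thesis using assms(2) by simp
qed

section \<open>One-sided slopes and boundary terms\<close>

definition dir_slope :: "(real \<Rightarrow> real) \<Rightarrow> real \<Rightarrow> real \<Rightarrow> real" where
  "dir_slope g t s = Lim (at_right 0) (\<lambda>h. (g (t + s * h) - g t) / h)"

lemma dir_slope_eqI:
  assumes "\<delta> > 0" and "\<And>h. 0 < h \<Longrightarrow> h < \<delta> \<Longrightarrow> g (t + s * h) = g t + m * h"
  shows "dir_slope g t s = m"
  unfolding dir_slope_def
proof (rule tendsto_Lim)
  have "eventually (\<lambda>h. (g (t + s * h) - g t) / h = m) (at_right 0)"
    unfolding eventually_at_right_field by (intro exI[of _ \<delta>]) (auto simp: assms)
  then show "((\<lambda>h. (g (t + s * h) - g t) / h) \<longlongrightarrow> m) (at_right 0)"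
    by (rule tendsto_eventually)
qed simp

lemma dir_slope_affine:
  assumes "u < v" and "\<And>t. u \<le> t \<Longrightarrow> t \<le> v \<Longrightarrow> g t = c + m * t"
  shows "dir_slope g u 1 = m" and "dir_slope g v (-1) = - m"
  by (rule dir_slope_eqI[of "v - u"]; use assms in \<open>simp add: algebra_simps\<close>)+

text \<open>
  The boundary terms of integrating \<open>g' (\<Phi> \<circ> g)'\<close> by parts piece by piece; slopes point away from
  the base point, so a leftward slope has the opposite sign of the derivative.
\<close>

definition boundary_sum ::
  "(real \<Rightarrow> real) \<Rightarrow> (real \<Rightarrow> real) \<Rightarrow> real set \<Rightarrow> real \<Rightarrow> real \<Rightarrow> real" where
  "boundary_sum \<Phi> g S a b =
     - (\<Phi> (g a) * dir_slope g a 1) - \<Phi> (g b) * dir_slope g b (-1)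
     - (\<Sum>t\<in>S \<inter> {a<..<b}. \<Phi> (g t) * (dir_slope g t 1 + dir_slope g t (-1)))"

lemma boundary_sum_affine:
  assumes "u < v" and "\<And>t. u \<le> t \<Longrightarrow> t \<le> v \<Longrightarrow> g t = c + m * t" and "{u<..<v} \<inter> S = {}"
  shows "boundary_sum \<Phi> g S u v = m * (\<Phi> (g v) - \<Phi> (g u))"
proof -
  have "S \<inter> {u<..<v} = {}" using assms(3) by blast
  then show ?thesis
    by (simp add: boundary_sum_def dir_slope_affine[OF assms(1,2)] algebra_simps)
qed

text \<open>The interior term at \<open>s\<close> is exactly the sum of the two end terms that the
  halves have there.\<close>

lemma boundary_sum_split:
  assumes "finite S" "u < s" "s < v" "s \<in> S"
  shows "boundary_sum \<Phi> g S u v = boundary_sum \<Phi> g S u s + boundary_sum \<Phi> g S s v"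
proof -
  have *: "S \<inter> {u<..<v} = insert s ((S \<inter> {u<..<s}) \<union> (S \<inter> {s<..<v}))" using assms by auto
  have "(\<Sum>t\<in>S \<inter> {u<..<v}. \<Phi> (g t) * (dir_slope g t 1 + dir_slope g t (-1))) =
     \<Phi> (g s) * (dir_slope g s 1 + dir_slope g s (-1)) +
     ((\<Sum>t\<in>S \<inter> {u<..<s}. \<Phi> (g t) * (dir_slope g t 1 + dir_slope g t (-1))) +
      (\<Sum>t\<in>S \<inter> {s<..<v}. \<Phi> (g t) * (dir_slope g t 1 + dir_slope g t (-1))))"
    unfolding * using assms(1) by (subst sum.insert, simp, simp, subst sum.union_disjoint) auto
  then show ?thesis by (simp add: boundary_sum_def algebra_simps)
qed

section \<open>Piecewise affine functions with named breakpoints\<close>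

text \<open>The condition of \<open>piecewise_affine\<close> on one edge, with the breakpoints
  exposed so that they can be enlarged and shared with \<open>boundary_sum\<close>.\<close>

definition affine_off :: "(real \<Rightarrow> real) \<Rightarrow> real set \<Rightarrow> real \<Rightarrow> bool" where
  "affine_off g S l \<longleftrightarrow> finite S \<and> (\<forall>a b. 0 \<le> a \<and> a \<le> b \<and> b \<le> l \<and> {a<..<b} \<inter> S = {} \<longrightarrow>
     (\<exists>c m. \<forall>t\<in>{a..b}. g t = c + m * t))"

lemma affine_offE:
  assumes "affine_off g S l" "0 \<le> u" "u < v" "v \<le> l" "{u<..<v} \<inter> S = {}"
  obtains c m where "\<And>t. u \<le> t \<Longrightarrow> t \<le> v \<Longrightarrow> g t = c + m * t"
proof -
  have "\<exists>c m. \<forall>t\<in>{u..v}. g t = c + m * t"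
    using assms unfolding affine_off_def by (metis less_imp_le)
  then show ?thesis using that by auto
qed

lemma affine_off_mono: "affine_off g S l \<Longrightarrow> finite S' \<Longrightarrow> S \<subseteq> S' \<Longrightarrow> affine_off g S' l"
  unfolding affine_off_def by blast

text \<open>The piece reaches to the nearest breakpoint in the given direction, or to the end of the
  interval; finiteness of \<open>S\<close> keeps its length positive.\<close>

lemma affine_off_piece:
  assumes "affine_off g S l" and "0 \<le> t" "t \<le> l" and "s = 1 \<and> t < l \<or> s = -1 \<and> 0 < t"
  obtains \<delta> m where "\<delta> > 0"
    and "\<And>h. 0 \<le> h \<Longrightarrow> h \<le> \<delta> \<Longrightarrow> 0 \<le> t + s * h \<and> t + s * h \<le> l \<and> g (t + s * h) = g t + m * h"
  using assms(4)
proof (elim disjE conjE)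
  have fin: "finite S" using assms(1) by (simp add: affine_off_def)
  {
    assume s: "s = 1" "t < l"
    define v where "v = Min (insert l (S \<inter> {t<..l}))"
    have v: "t < v" "v \<le> l" using fin s by (auto simp: v_def)
    have "r \<notin> S" if "t < r" "r < v" for r
    proof
      assume "r \<in> S"
      then have "r \<in> insert l (S \<inter> {t<..l})" using that v by auto
      then have "v \<le> r" unfolding v_def using fin by (intro Min_le) auto
      then show False using that by simp
    qed
    then have "{t<..<v} \<inter> S = {}" by auto
    from affine_offE[OF assms(1,2) v this] obtain c m where
      *: "\<And>r. t \<le> r \<Longrightarrow> r \<le> v \<Longrightarrow> g r = c + m * r" by blast
    show thesis
      by (rule that[of "v - t" m]) (use * v assms s in \<open>auto simp: algebra_simps\<close>)
  next
    assume s: "s = -1" "0 < t"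
    define u where "u = Max (insert 0 (S \<inter> {0..<t}))"
    have u: "0 \<le> u" "u < t" using fin s by (auto simp: u_def)
    have "r \<notin> S" if "u < r" "r < t" for r
    proof
      assume "r \<in> S"
      then have "r \<in> insert 0 (S \<inter> {0..<t})" using that u by auto
      then have "r \<le> u" unfolding u_def using fin by (intro Max_ge) auto
      then show False using that by simp
    qed
    then have "{u<..<t} \<inter> S = {}" by auto
    from affine_offE[OF assms(1) u assms(3) this] obtain c m where
      *: "\<And>r. u \<le> r \<Longrightarrow> r \<le> t \<Longrightarrow> g r = c + m * r" by blast
    show thesis
      by (rule that[of "t - u" "- m"]) (use * u assms s in \<open>auto simp: algebra_simps\<close>)
  }
qed

text \<open>On an affine piece the value is the slope times the increment of
  \<open>\<Phi> \<circ> g\<close>, two factors that cannot have opposite signs. If the product is 0,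
  either \<open>g\<close> is constant, or \<open>\<Phi> \<circ> g\<close> is monotone or antitone
  with equal end values. Nonnegative pieces with sum 0 all vanish, and the constants agree at the
  breakpoints.\<close>

lemma boundary_sum_mono:
  assumes "affine_off g S l" "0 \<le> a" "a < b" "b \<le> l" "mono \<Phi>"
  shows "boundary_sum \<Phi> g S a b \<ge> 0 \<and>
    (boundary_sum \<Phi> g S a b = 0 \<longrightarrow> (\<forall>t\<in>{a..b}. \<Phi> (g t) = \<Phi> (g a)))"
proof -
  have "finite S" using assms(1) by (simp add: affine_off_def)
  from this \<open>a < b\<close> show ?thesis
  proof (induction rule: breakpoint_induct)
    case (affine u v)
    then have "0 \<le> u" "v \<le> l" using assms by auto
    from affine_offE[OF assms(1) this(1) affine(2) this(2) affine(4)] obtain c m where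
      g: "\<And>r. u \<le> r \<Longrightarrow> r \<le> v \<Longrightarrow> g r = c + m * r" by blast
    have *: "boundary_sum \<Phi> g S u v = m * (\<Phi> (g v) - \<Phi> (g u))"
      by (rule boundary_sum_affine[OF affine(2) g affine(4)])
    consider "m = 0" | "m > 0" | "m < 0" by linarith
    then show ?case
    proof cases
      case 1
      then show ?thesis using * g affine by simp
    next
      case 2
      have le: "\<Phi> (g u) \<le> \<Phi> (g t)" "\<Phi> (g t) \<le> \<Phi> (g v)" if "t \<in> {u..v}" for t
        using that 2 g by (auto intro!: monoD[OF assms(5)])
      have "\<Phi> (g u) \<le> \<Phi> (g v)" using le(1)[of v] affine by simp
      moreover have "\<Phi> (g t) = \<Phi> (g u)" if "\<Phi> (g v) = \<Phi> (g u)" "t \<in> {u..v}" for t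
        using le[OF that(2)] that(1) by linarith
      moreover have "boundary_sum \<Phi> g S u v = 0 \<longleftrightarrow> \<Phi> (g v) = \<Phi> (g u)" using 2 * by auto
      ultimately show ?thesis using 2 unfolding * by (metis mult_nonneg_nonneg mult_nonpos_nonpos diff_ge_0_iff_ge diff_le_0_iff_le less_imp_le)
    next
      case 3
      have le: "\<Phi> (g t) \<le> \<Phi> (g u)" "\<Phi> (g v) \<le> \<Phi> (g t)" if "t \<in> {u..v}" for t
        using that 3 g by (auto intro!: monoD[OF assms(5)])
      have "\<Phi> (g v) \<le> \<Phi> (g u)" using le(1)[of v] affine by simp
      moreover have "\<Phi> (g t) = \<Phi> (g u)" if "\<Phi> (g v) = \<Phi> (g u)" "t \<in> {u..v}" for t
        using le[OF that(2)] that(1) by linarith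
      moreover have "boundary_sum \<Phi> g S u v = 0 \<longleftrightarrow> \<Phi> (g v) = \<Phi> (g u)" using 3 * by auto
      ultimately show ?thesis using 3 unfolding * by (metis mult_nonneg_nonneg mult_nonpos_nonpos diff_ge_0_iff_ge diff_le_0_iff_le less_imp_le)
    qed
  next
    case (split u s v)
    have "boundary_sum \<Phi> g S u v = boundary_sum \<Phi> g S u s + boundary_sum \<Phi> g S s v"
      using boundary_sum_split[OF \<open>finite S\<close>] split by blast
    moreover have "\<Phi> (g t) = \<Phi> (g u)"
      if "\<forall>t\<in>{u..s}. \<Phi> (g t) = \<Phi> (g u)" "\<forall>t\<in>{s..v}. \<Phi> (g t) = \<Phi> (g s)" "t \<in> {u..v}" for t
    proof (cases "t \<le> s")
      case True
      then show ?thesis by (intro that(1)[rule_format]) (use that(3) in simp)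
    next
      case False
      then have "\<Phi> (g t) = \<Phi> (g s)" by (intro that(2)[rule_format]) (use that(3) in simp)
      also have "\<dots> = \<Phi> (g u)" by (intro that(1)[rule_format]) (use split.hyps in simp)
      finally show ?thesis .
    qed
    ultimately show ?case using split.IH by (smt (verit))
  qed
qed

section \<open>Integrals of powers over affine pieces\<close>

text \<open>For negative \<open>n\<close> the integrand may blow up at an end where
  \<open>c + m * t\<close> vanishes. The fundamental theorem is therefore applied on the open
  interval, with one-sided limits of the antiderivative.\<close>

lemma affine_power_integral:
  fixes c m n u v :: real
  assumes "u < v" and nonneg: "\<And>t. u \<le> t \<Longrightarrow> t \<le> v \<Longrightarrow> 0 \<le> c + m * t" and n: "n > -1"
  shows "has_bochner_integral lborel (\<lambda>t. indicator {u..v} t *\<^sub>R (m\<^sup>2 * (c + m * t) powr n))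
    (m * ((c + m * v) powr (n + 1) / (n + 1) - (c + m * u) powr (n + 1) / (n + 1)))"
proof (cases "m = 0")
  case True
  then show ?thesis by (simp add: has_bochner_integral_zero)
next
  case False
  define F where "F t = m * ((c + m * t) powr (n + 1) / (n + 1))" for t
  \<comment> \<open>A nonconstant affine function that is nonnegative at both ends is positive
    strictly between them.\<close>
  have pos: "0 < c + m * t" if "u < t" "t < v" for t
  proof (cases "m > 0")
    case True
    then have "m * u < m * t" using that by simp
    then show ?thesis using nonneg[of u] \<open>u < v\<close> by simp
  next
    case f: False
    then have "m * v < m * t" using that \<open>m \<noteq> 0\<close> by (simp add: mult_less_cancel_left)
    then show ?thesis using nonneg[of v] \<open>u < v\<close> by simp
  qed
  \<comment> \<open>Continuity where the base vanishes rests on the exponent \<open>n + 1\<close>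
    being positive.\<close>
  have contF: "continuous_on {u..v} F" unfolding F_def
    by (intro continuous_intros continuous_on_powr') (use nonneg n in auto)
  have limR: "((F \<circ> real_of_ereal) \<longlongrightarrow> F u) (at_right (ereal u))"
    unfolding at_right_ereal filterlim_filtermap comp_def
    using contF \<open>u < v\<close> by (simp add: continuous_on_Icc_at_rightD)
  have limL: "((F \<circ> real_of_ereal) \<longlongrightarrow> F v) (at_left (ereal v))"
    unfolding at_left_ereal filterlim_filtermap comp_def
    using contF \<open>u < v\<close> by (simp add: continuous_on_Icc_at_leftD)
  have D: "(F has_real_derivative m\<^sup>2 * (c + m * t) powr n) (at t)" if "u < t" "t < v" for t
  proof -
    have "(F has_real_derivative m * ((n + 1) * (c + m * t) powr (n + 1 - 1) * m / (n + 1))) (at t)"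
      unfolding F_def using pos[OF that]
      by (auto intro!: derivative_eq_intros simp: divide_simps)
    moreover have "m * ((n + 1) * (c + m * t) powr (n + 1 - 1) * m / (n + 1)) = m\<^sup>2 * (c + m * t) powr n"
      using n by (simp add: power2_eq_square)
    ultimately show ?thesis by simp
  qed
  have cont: "isCont (\<lambda>t. m\<^sup>2 * (c + m * t) powr n) t" if "u < t" "t < v" for t
    using pos[OF that] by (intro continuous_intros) auto
  note FTC = interval_integral_FTC_nonneg[of "ereal u" "ereal v" F, OF _ D cont _ limR limL]
  have I: "set_integrable lborel (einterval u v) (\<lambda>t. m\<^sup>2 * (c + m * t) powr n)"
    and E: "(LBINT t=u..v. m\<^sup>2 * (c + m * t) powr n) = F v - F u"
    by (rule FTC; use \<open>u < v\<close> in simp)+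
  have "has_bochner_integral lborel (\<lambda>t. indicator {u<..<v} t *\<^sub>R (m\<^sup>2 * (c + m * t) powr n)) (F v - F u)"
  proof -
    have ein: "einterval (ereal u) (ereal v) = {u<..<v}" by (auto simp: einterval_def)
    have "(LBINT t:{u<..<v}. m\<^sup>2 * (c + m * t) powr n) = F v - F u"
      using E \<open>u < v\<close> unfolding interval_lebesgue_integral_def ein
      by (simp only: ereal_less_eq less_imp_le if_True)
    then show ?thesis
      using I unfolding ein has_bochner_integral_iff set_integrable_def set_lebesgue_integral_def by blast
  qed
  \<comment> \<open>Adding the two end points changes the integrand only on a null set, whatever
    value \<open>powr\<close> takes there.\<close>
  then have "has_bochner_integral lborel (\<lambda>t. indicator {u..v} t *\<^sub>R (m\<^sup>2 * (c + m * t) powr n)) (F v - F u)"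
    by (rule has_bochner_integral_discrete_difference[where X = "{u, v}", THEN iffD1, rotated -1])
      (auto simp: indicator_def)
  then show ?thesis by (simp add: F_def right_diff_distrib)
qed

text \<open>\<open>D\<close> is tied to \<open>deriv g\<close> only in the open interval, because
  \<open>edge_deriv\<close> is set to 0 at vertices. Ends and breakpoints together form a null
  set.\<close>

lemma power_integral_eq_boundary_sum:
  assumes g: "affine_off g S l" and "0 \<le> a" "a < b" "b \<le> l"
    and nonneg: "\<And>t. 0 \<le> t \<Longrightarrow> t \<le> l \<Longrightarrow> 0 \<le> g t"
    and D: "\<And>t. 0 < t \<Longrightarrow> t < l \<Longrightarrow> D t = deriv g t" and n: "n > -1"
  shows "has_bochner_integral lborel (\<lambda>t. indicator {a..b} t *\<^sub>R ((D t)\<^sup>2 * g t powr n))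
    (boundary_sum (\<lambda>y. y powr (n + 1) / (n + 1)) g S a b)"
proof -
  have "finite S" using g by (simp add: affine_off_def)
  from this \<open>a < b\<close> show ?thesis
  proof (induction rule: breakpoint_induct)
    case (affine u v)
    then have uv: "0 \<le> u" "v \<le> l" using assms by auto
    from affine_offE[OF g uv(1) affine(2) uv(2) affine(4)] obtain c m where
      g': "\<And>r. u \<le> r \<Longrightarrow> r \<le> v \<Longrightarrow> g r = c + m * r" by blast
    have D': "D t = m" if "u < t" "t < v" for t
    proof -
      have "((\<lambda>r. c + m * r) has_field_derivative m) (at t)"
        by (auto intro!: derivative_eq_intros)
      then have "(g has_field_derivative m) (at t)"
        by (rule has_field_derivative_transform_within_open[where S = "{u<..<v}"])
          (use that g' in auto)
      then show ?thesis using D[of t] that uv by (simp add: DERIV_imp_deriv)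
    qed
    have "0 \<le> c + m * t" if "u \<le> t" "t \<le> v" for t
      using nonneg[of t] g'[of t] that uv by simp
    from affine_power_integral[OF \<open>u < v\<close> this n]
    have "has_bochner_integral lborel (\<lambda>t. indicator {u..v} t *\<^sub>R (m\<^sup>2 * (c + m * t) powr n))
      (boundary_sum (\<lambda>y. y powr (n + 1) / (n + 1)) g S u v)"
      using boundary_sum_affine[OF affine(2) g' affine(4)] g' affine by simp
    then show ?case
      by (rule has_bochner_integral_discrete_difference[where X = "{u, v}", THEN iffD1, rotated -1])
        (auto simp: indicator_def D' g')
  next
    case (split u s v)
    \<comment> \<open>Both closed halves contain \<open>s\<close>, so their sum counts the integrand
      twice there, again on a null set.\<close>
    show ?case unfolding boundary_sum_split[OF \<open>finite S\<close> split(2,3,5)]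
      by (rule has_bochner_integral_discrete_difference[where X = "{s}", THEN iffD1, rotated -1,
            OF has_bochner_integral_add[OF split.IH]])
        (use split.hyps in \<open>auto simp: indicator_def\<close>)
  qed
qed

section \<open>Potentials on a metrized graph\<close>

context metrized_graph
begin

section \<open>Net currents and superposition\<close>

definition net_current :: "(('v, 'e) gpoint \<Rightarrow> real) \<Rightarrow> ('v, 'e) gpoint \<Rightarrow> real" where
  "net_current f x = (\<Sum>d\<in>directions G len x. - slope G len f d)"

text \<open>Arbitrary sources \<open>b\<close> are allowed because linear combinations of unit
  current potentials leave that class.\<close>

definition has_net_current ::
  "(('v, 'e) gpoint \<Rightarrow> real) \<Rightarrow> (('v, 'e) gpoint \<Rightarrow> real) \<Rightarrow> bool" where
  "has_net_current f b \<longleftrightarrow> piecewise_affine G len f \<and> (\<forall>x\<in>points G len. net_current f x = b x)"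

lemma unit_current_potential_iff:
  "unit_current_potential G len y z f \<longleftrightarrow>
     has_net_current f (\<lambda>x. of_bool (x = y) - of_bool (x = z))"
  by (simp add: unit_current_potential_def has_net_current_def net_current_def)

lemma slope_eq: "slope G len f (e, t, s) = dir_slope (\<lambda>r. f (edge_point G len e r)) t s"
  by (simp add: slope_def dir_slope_def)

lemma piecewise_affine_iff:
  "piecewise_affine G len f \<longleftrightarrow>
     (\<forall>e\<in>arcs G. \<exists>S. affine_off (\<lambda>t. f (edge_point G len e t)) S (len e))"
  by (simp add: piecewise_affine_def affine_off_def)

lemma edge_point_simps:
  "edge_point G len e 0 = Vertex (tail G e)"
  "e \<in> arcs G \<Longrightarrow> edge_point G len e (len e) = Vertex (head G e)"
  "0 < t \<Longrightarrow> t < len e \<Longrightarrow> edge_point G len e t = Inner e t"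
  by (auto simp: edge_point_def dest: len_pos)

lemma edge_point_in_points:
  "e \<in> arcs G \<Longrightarrow> 0 \<le> t \<Longrightarrow> t \<le> len e \<Longrightarrow> edge_point G len e t \<in> points G len"
  by (auto simp: edge_point_def points_def)

lemma directions_Vertex:
  "directions G len (Vertex v) =
     (\<lambda>e. (e, 0, 1)) ` {e \<in> arcs G. tail G e = v} \<union>
     (\<lambda>e. (e, len e, -1)) ` {e \<in> arcs G. head G e = v}"
  using len_pos by (fastforce simp: directions_def edge_point_def split: if_splits)

lemma directions_Inner:
  "e \<in> arcs G \<Longrightarrow> 0 < t \<Longrightarrow> t < len e \<Longrightarrow>
     directions G len (Inner e t) = {(e, t, 1), (e, t, -1)}"
  by (auto simp: directions_def edge_point_def split: if_splits)

text \<open>Indicators over all arcs give the shape of the equations in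
  \<open>network_potential_exists\<close> and count a loop with both of its directions.\<close>

lemma net_current_Vertex:
  "net_current f (Vertex v) =
     - (\<Sum>e\<in>arcs G. of_bool (tail G e = v) * slope G len f (e, 0, 1) +
         of_bool (head G e = v) * slope G len f (e, len e, -1))"
proof -
  have "net_current f (Vertex v) =
      (\<Sum>e\<in>{e \<in> arcs G. tail G e = v}. - slope G len f (e, 0, 1)) +
      (\<Sum>e\<in>{e \<in> arcs G. head G e = v}. - slope G len f (e, len e, -1))"
    unfolding net_current_def directions_Vertex
    by (subst sum.union_disjoint) (auto simp: sum.reindex inj_on_def)
  also have "(\<Sum>e\<in>{e \<in> arcs G. tail G e = v}. - slope G len f (e, 0, 1)) =
      (\<Sum>e\<in>arcs G. - (of_bool (tail G e = v) * slope G len f (e, 0, 1)))"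
    by (rule sum.mono_neutral_cong_left) auto
  also have "(\<Sum>e\<in>{e \<in> arcs G. head G e = v}. - slope G len f (e, len e, -1)) =
      (\<Sum>e\<in>arcs G. - (of_bool (head G e = v) * slope G len f (e, len e, -1)))"
    by (rule sum.mono_neutral_cong_left) auto
  finally show ?thesis by (simp add: sum.distrib sum_negf)
qed

lemma net_current_Inner:
  "e \<in> arcs G \<Longrightarrow> 0 < t \<Longrightarrow> t < len e \<Longrightarrow>
     net_current f (Inner e t) = - slope G len f (e, t, 1) - slope G len f (e, t, -1)"
  by (simp add: net_current_def directions_Inner)

text \<open>\<open>slope\<close> is a \<open>Lim\<close>, which says nothing unless the limit
  exists. Exact affinity on an initial segment supplies it and makes slopes computable for altered
  or combined functions.\<close>

lemma piecewise_affine_direction: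
  assumes "piecewise_affine G len f" and "(e, t, s) \<in> directions G len x"
  obtains \<delta> where "\<delta> > 0"
    and "\<And>h. 0 \<le> h \<Longrightarrow> h \<le> \<delta> \<Longrightarrow> edge_point G len e (t + s * h) \<in> points G len \<and>
      f (edge_point G len e (t + s * h)) = f (edge_point G len e t) + slope G len f (e, t, s) * h"
proof -
  have d: "e \<in> arcs G" "0 \<le> t" "t \<le> len e" "s = 1 \<and> t < len e \<or> s = -1 \<and> 0 < t"
    using assms(2) by (auto simp: directions_def)
  then obtain S where "affine_off (\<lambda>t. f (edge_point G len e t)) S (len e)"
    using assms(1) unfolding piecewise_affine_iff by blast
  from affine_off_piece[OF this d(2-4)] obtain \<delta> m where \<delta>: "\<delta> > 0"
    and *: "\<And>h. 0 \<le> h \<Longrightarrow> h \<le> \<delta> \<Longrightarrow> 0 \<le> t + s * h \<and> t + s * h \<le> len e \<and>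
       f (edge_point G len e (t + s * h)) = f (edge_point G len e t) + m * h" by blast
  have "slope G len f (e, t, s) = m"
    unfolding slope_eq by (rule dir_slope_eqI[OF \<delta>]) (use * in simp)
  then show thesis using that[OF \<delta>] * edge_point_in_points d(1) by simp
qed

text \<open>Allows passing to the extensional representative demanded by
  \<open>potential_j\<close>.\<close>

lemma has_net_current_cong:
  assumes "has_net_current f b" and eq: "\<And>x. x \<in> points G len \<Longrightarrow> f' x = f x"
  shows "has_net_current f' b"
proof -
  have f: "piecewise_affine G len f" using assms(1) by (simp add: has_net_current_def)
  have "piecewise_affine G len f'"
    unfolding piecewise_affine_iff
  proof
    fix e assume e: "e \<in> arcs G"
    have eq': "f' (edge_point G len e t) = f (edge_point G len e t)" if "0 \<le> t" "t \<le> len e" for t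
      using eq edge_point_in_points e that by simp
    obtain S where S: "affine_off (\<lambda>t. f (edge_point G len e t)) S (len e)"
      using f e unfolding piecewise_affine_iff by blast
    have "\<exists>c m. \<forall>t\<in>{a..b}. f' (edge_point G len e t) = c + m * t"
      if ab: "0 \<le> a \<and> a \<le> b \<and> b \<le> len e \<and> {a<..<b} \<inter> S = {}" for a b
    proof -
      obtain c m where "\<forall>t\<in>{a..b}. f (edge_point G len e t) = c + m * t" using S ab unfolding affine_off_def by blast
      then have "\<forall>t\<in>{a..b}. f' (edge_point G len e t) = c + m * t" using eq' ab by simp
      then show ?thesis by blast
    qed
    then show "\<exists>S. affine_off (\<lambda>t. f' (edge_point G len e t)) S (len e)"
      using S unfolding affine_off_def by blast
  qed
  moreover have "slope G len f' d = slope G len f d" if dir: "d \<in> directions G len x" for d x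
  proof -
    obtain e t s where d: "d = (e, t, s)" by (cases d)
    have t: "edge_point G len e t \<in> points G len"
      using dir d by (auto simp: directions_def intro: edge_point_in_points)
    obtain \<delta> where \<delta>: "\<delta> > 0" "\<And>h. 0 \<le> h \<Longrightarrow> h \<le> \<delta> \<Longrightarrow>
        edge_point G len e (t + s * h) \<in> points G len \<and>
        f (edge_point G len e (t + s * h)) = f (edge_point G len e t) + slope G len f (e, t, s) * h"
      by (rule piecewise_affine_direction[OF f dir[unfolded d]], rule that)
    show ?thesis unfolding d slope_eq[of f']
      by (rule dir_slope_eqI[OF \<delta>(1)]) (use \<delta>(2) eq t in simp)
  qed
  ultimately show ?thesis using assms(1) by (simp add: has_net_current_def net_current_def)
qed

lemma has_net_current_lincomb:
  assumes "has_net_current f b" and "has_net_current f' b'"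
  shows "has_net_current (\<lambda>x. \<alpha> * f x + \<beta> * f' x) (\<lambda>x. \<alpha> * b x + \<beta> * b' x)"
proof -
  let ?F = "\<lambda>x. \<alpha> * f x + \<beta> * f' x"
  have f: "piecewise_affine G len f" "piecewise_affine G len f'"
    using assms by (simp_all add: has_net_current_def)
  have "piecewise_affine G len ?F"
    unfolding piecewise_affine_iff
  proof
    fix e assume e: "e \<in> arcs G"
    let ?g = "\<lambda>t. f (edge_point G len e t)" and ?g' = "\<lambda>t. f' (edge_point G len e t)"
    obtain S S' where S: "affine_off ?g S (len e)" "affine_off ?g' S' (len e)"
      using f e unfolding piecewise_affine_iff by blast
    have "affine_off (\<lambda>t. \<alpha> * ?g t + \<beta> * ?g' t) (S \<union> S') (len e)"
      unfolding affine_off_def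
    proof (intro conjI allI impI)
      show "finite (S \<union> S')" using S by (simp add: affine_off_def)
      fix u v assume uv: "0 \<le> u \<and> u \<le> v \<and> v \<le> len e \<and> {u<..<v} \<inter> (S \<union> S') = {}"
      then have "{u<..<v} \<inter> S = {}" "{u<..<v} \<inter> S' = {}" by auto
      then obtain c m c' m' where "\<forall>t\<in>{u..v}. ?g t = c + m * t" "\<forall>t\<in>{u..v}. ?g' t = c' + m' * t"
        using S uv unfolding affine_off_def by blast
      then have "\<forall>t\<in>{u..v}. \<alpha> * ?g t + \<beta> * ?g' t = (\<alpha> * c + \<beta> * c') + (\<alpha> * m + \<beta> * m') * t"
        by (simp add: algebra_simps)
      then show "\<exists>c m. \<forall>t\<in>{u..v}. \<alpha> * ?g t + \<beta> * ?g' t = c + m * t" by blast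
    qed
    then show "\<exists>S. affine_off (\<lambda>t. \<alpha> * ?g t + \<beta> * ?g' t) S (len e)" by blast
  qed
  moreover have "slope G len ?F d = \<alpha> * slope G len f d + \<beta> * slope G len f' d"
    if dir: "d \<in> directions G len x" for d x
  proof -
    obtain e t s where d: "d = (e, t, s)" by (cases d)
    obtain \<delta> where \<delta>: "\<delta> > 0" "\<And>h. 0 \<le> h \<Longrightarrow> h \<le> \<delta> \<Longrightarrow>
        edge_point G len e (t + s * h) \<in> points G len \<and>
        f (edge_point G len e (t + s * h)) = f (edge_point G len e t) + slope G len f (e, t, s) * h"
      by (rule piecewise_affine_direction[OF f(1) dir[unfolded d]], rule that)
    obtain \<delta>' where \<delta>': "\<delta>' > 0" "\<And>h. 0 \<le> h \<Longrightarrow> h \<le> \<delta>' \<Longrightarrow>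
        edge_point G len e (t + s * h) \<in> points G len \<and>
        f' (edge_point G len e (t + s * h)) = f' (edge_point G len e t) + slope G len f' (e, t, s) * h"
      by (rule piecewise_affine_direction[OF f(2) dir[unfolded d]], rule that)
    show ?thesis unfolding d slope_eq[of ?F]
      by (rule dir_slope_eqI[of "min \<delta> \<delta>'"]) (use \<delta> \<delta>' in \<open>auto simp: algebra_simps\<close>)
  qed
  then have "net_current ?F x = \<alpha> * net_current f x + \<beta> * net_current f' x" for x
    unfolding net_current_def sum_distrib_left sum.distrib[symmetric]
    by (intro sum.cong) simp_all
  ultimately show ?thesis using assms by (simp add: has_net_current_def)
qed

lemma has_net_current_const: "has_net_current (\<lambda>x. c) (\<lambda>x. 0)"
proof -
  have "slope G len (\<lambda>x. c) d = 0" for d :: "'e \<times> real \<times> real"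
    by (cases d) (simp only: slope_eq, rule dir_slope_eqI[of 1], auto)
  moreover have "piecewise_affine G len (\<lambda>x. c)"
    unfolding piecewise_affine_def by (intro ballI exI[of _ "{}"]) (auto intro: exI[of _ c] exI[of _ 0])
  ultimately show ?thesis by (simp add: has_net_current_def net_current_def)
qed

section \<open>Existence of unit current potentials\<close>

text \<open>Connectedness means reachability in the symmetric closure, so equality propagates along
  walks that traverse arcs either way.\<close>

lemma constant_along_arcs_imp_constant:
  assumes "\<And>e. e \<in> arcs G \<Longrightarrow> \<phi> (tail G e) = \<phi> (head G e)" and "u \<in> verts G" "v \<in> verts G"
  shows "\<phi> u = \<phi> v"
proof -
  have "u \<rightarrow>\<^sup>*\<^bsub>mk_symmetric G\<^esub> v"
    using connected_graph assms(2,3) by (auto simp: connected_def strongly_connected_def)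
  then show ?thesis
    unfolding reachable_def
  proof (induction rule: rtrancl_on_induct)
    case (step y z)
    then have "\<phi> y = \<phi> z"
      using assms(1) by (auto simp: parcs_mk_symmetric)
    then show ?case using step by simp
  qed simp
qed

text \<open>With conductances \<open>1 / len e\<close>, Kirchhoff's law at the vertices is the
  system of \<open>network_potential_exists\<close>. Its test functions are constant by
  connectedness, and the source has total 0. Affine interpolation creates no current inside
  edges.\<close>

lemma vertex_current_exists:
  assumes "u \<in> verts G" "v \<in> verts G"
  obtains f where "has_net_current f (\<lambda>x. of_bool (x = Vertex u) - of_bool (x = Vertex v))"
proof -
  let ?b = "\<lambda>x. of_bool (x = u) - of_bool (x = v) :: real"
  have "\<exists>g. \<forall>x\<in>verts G. (\<Sum>e\<in>arcs G. (1 / len e) * (g (tail G e) - g (head G e)) *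
      (of_bool (tail G e = x) - of_bool (head G e = x))) = ?b x"
  proof (rule network_potential_exists)
    fix \<phi> :: "'v \<Rightarrow> real" assume "\<And>e. e \<in> arcs G \<Longrightarrow> \<phi> (tail G e) = \<phi> (head G e)"
    then have "\<phi> u = \<phi> v" using constant_along_arcs_imp_constant assms by blast
    moreover have "(\<Sum>x\<in>verts G. of_bool (x = w) * \<phi> x) = \<phi> w" if "w \<in> verts G" for w
      using that by (subst sum.mono_neutral_right[of _ "{w}"]) auto
    ultimately show "(\<Sum>x\<in>verts G. ?b x * \<phi> x) = 0"
      using assms by (simp add: left_diff_distrib sum_subtractf)
  qed (use len_pos in auto)
  then obtain g :: "'v \<Rightarrow> real" where g: "\<And>x. x \<in> verts G \<Longrightarrow>
      (\<Sum>e\<in>arcs G. (1 / len e) * (g (tail G e) - g (head G e)) *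
        (of_bool (tail G e = x) - of_bool (head G e = x))) = ?b x" by blast
  define m where "m e = (g (head G e) - g (tail G e)) / len e" for e
  define f where "f x = (case x of Vertex v \<Rightarrow> g v | Inner e t \<Rightarrow> g (tail G e) + m e * t)" for x
  \<comment> \<open>This holds for all real \<open>t\<close>: beyond the edge,
    \<open>edge_point\<close> yields \<open>Inner e t\<close>, where \<open>f\<close> follows the
    same formula. Hence any radius, here \<open>1\<close>, serves for the slopes.\<close>
  have f: "f (edge_point G len e t) = g (tail G e) + m e * t" if "e \<in> arcs G" for e t
    using len_pos[OF that] by (auto simp: f_def m_def edge_point_def)
  have sl: "slope G len f (e, t, s) = m e * s" if "e \<in> arcs G" for e t s
    unfolding slope_eq by (rule dir_slope_eqI[of 1]) (simp_all add: f that algebra_simps)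
  have "piecewise_affine G len f"
    unfolding piecewise_affine_def by (intro ballI exI[of _ "{}"]) (auto simp: f)
  moreover have "net_current f (Vertex x) = ?b x" if "x \<in> verts G" for x
    unfolding net_current_Vertex g[OF that, symmetric] sum_negf[symmetric]
    by (rule sum.cong) (auto simp: sl m_def algebra_simps divide_simps)
  moreover have "net_current f (Inner e t) = 0" if "e \<in> arcs G" "0 < t" "t < len e" for e t
    using that by (simp add: net_current_Inner sl)
  ultimately show thesis
    by (intro that[of f]) (auto simp: has_net_current_def points_def)
qed

text \<open>An interior source is first led to the ends of its edge, in the fractions
  \<open>1 - t / l\<close> and \<open>t / l\<close>; two vertex potentials with these weights carry
  the current on to \<open>v\<close>.\<close>

lemma point_current_exists:
  assumes "x \<in> points G len" "v \<in> verts G"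
  obtains f where "has_net_current f (\<lambda>y. of_bool (y = x) - of_bool (y = Vertex v))"
proof (cases x)
  case (Vertex u)
  then have "u \<in> verts G" using assms(1) by (auto simp: points_def)
  then show thesis using vertex_current_exists[OF _ assms(2)] that Vertex by metis
next
  case (Inner e t)
  then have e: "e \<in> arcs G" "0 < t" "t < len e" using assms(1) by (auto simp: points_def)
  define l where "l = len e"
  have l: "l > 0" "t < l" using e by (auto simp: l_def)
  \<comment> \<open>Unit current entering at \<open>x\<close> and leaving through the ends of \<open>e\<close> when these are at potential \<open>0\<close>.\<close>
  define tent where "tent y = (case y of Vertex w \<Rightarrow> 0 | Inner e' s \<Rightarrow>
     if e' = e then if s \<le> t then (1 - t / l) * s else t * (1 - s / l) else 0)" for y :: "('v, 'e) gpoint"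
  have tent1: "tent (edge_point G len e s) = 0 + (1 - t / l) * s" if "0 \<le> s" "s \<le> t" for s
    using that e by (auto simp: tent_def edge_point_def l_def)
  have tent2: "tent (edge_point G len e s) = t + - (t / l) * s" if "t \<le> s" "s \<le> l" for s
    using that e l by (auto simp: tent_def edge_point_def l_def field_simps)
  have tent3: "tent (edge_point G len e' s) = 0" if "e' \<noteq> e" for e' s
    using that by (auto simp: tent_def edge_point_def)
  have sl: "slope G len tent (e, 0, 1) = 1 - t / l" "slope G len tent (e, t, -1) = - (1 - t / l)"
    "slope G len tent (e, t, 1) = - (t / l)" "slope G len tent (e, len e, -1) = t / l"
    using dir_slope_affine[OF e(2), of "\<lambda>r. tent (edge_point G len e r)", OF tent1]
      dir_slope_affine[OF l(2), of "\<lambda>r. tent (edge_point G len e r)", OF tent2]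
    by (simp_all add: slope_eq l_def)
  have sl0: "slope G len tent (e', s, r) = 0" if "e' \<noteq> e" for e' s r
    unfolding slope_eq by (rule dir_slope_eqI[of 1]) (simp_all add: tent3[OF that])
  have sl1: "slope G len tent (e, s, r) = (1 - t / l) * r" if "0 < s" "s < t" for s r
  proof -
    show ?thesis unfolding slope_eq
    \<comment> \<open>The radius keeps \<open>s + r * h\<close> on the left side of the tent; the
      summand \<open>1\<close> covers \<open>r = 0\<close>.\<close>
    proof (rule dir_slope_eqI[of "min s (t - s) / (1 + \<bar>r\<bar>)"])
      fix h assume h: "0 < h" "h < min s (t - s) / (1 + \<bar>r\<bar>)"
      then have "h * (1 + \<bar>r\<bar>) < min s (t - s)" by (simp add: pos_less_divide_eq)
      moreover have "\<bar>r * h\<bar> \<le> h * (1 + \<bar>r\<bar>)" using h by (simp add: abs_mult algebra_simps)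
      ultimately have "0 \<le> s + r * h" "s + r * h \<le> t" by linarith+
      then show "tent (edge_point G len e (s + r * h)) = tent (edge_point G len e s) + (1 - t / l) * r * h"
        using that by (simp add: tent1 algebra_simps)
    qed (use that in \<open>simp add: add_pos_nonneg\<close>)
  qed
  have sl2: "slope G len tent (e, s, r) = - (t / l) * r" if "t < s" "s < l" for s r
  proof -
    show ?thesis unfolding slope_eq
    proof (rule dir_slope_eqI[of "min (s - t) (l - s) / (1 + \<bar>r\<bar>)"])
      fix h assume h: "0 < h" "h < min (s - t) (l - s) / (1 + \<bar>r\<bar>)"
      then have "h * (1 + \<bar>r\<bar>) < min (s - t) (l - s)" by (simp add: pos_less_divide_eq)
      moreover have "\<bar>r * h\<bar> \<le> h * (1 + \<bar>r\<bar>)" using h by (simp add: abs_mult algebra_simps)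
      ultimately have "t \<le> s + r * h" "s + r * h \<le> l" by linarith+
      then show "tent (edge_point G len e (s + r * h)) = tent (edge_point G len e s) + - (t / l) * r * h"
        using that by (simp add: tent2 algebra_simps)
    qed (use that in \<open>simp add: add_pos_nonneg\<close>)
  qed
  have "affine_off (\<lambda>s. tent (edge_point G len e' s)) {t} (len e')" if "e' \<in> arcs G" for e'
    unfolding affine_off_def
  proof (intro conjI allI impI)
    fix u v assume uv: "0 \<le> u \<and> u \<le> v \<and> v \<le> len e' \<and> {u<..<v} \<inter> {t} = {}"
    consider "e' \<noteq> e" | "e' = e" "v \<le> t" | "e' = e" "t \<le> u" using uv by force
    then show "\<exists>c m. \<forall>s\<in>{u..v}. tent (edge_point G len e' s) = c + m * s"
    proof cases
      case 1
      then show ?thesis using tent3 by (intro exI[of _ 0]) simp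
    next
      case 2
      then have "\<forall>s\<in>{u..v}. tent (edge_point G len e' s) = 0 + (1 - t / l) * s"
        using uv tent1 by simp
      then show ?thesis by blast
    next
      case 3
      then have "\<forall>s\<in>{u..v}. tent (edge_point G len e' s) = t + - (t / l) * s"
        using uv tent2 by (simp add: l_def)
      then show ?thesis by blast
    qed
  qed simp
  then have "piecewise_affine G len tent" unfolding piecewise_affine_iff by blast
  moreover have "net_current tent (Vertex w) =
      - (1 - t / l) * of_bool (w = tail G e) - t / l * of_bool (w = head G e)" for w
  proof -
    have "(\<Sum>e'\<in>arcs G. of_bool (tail G e' = w) * slope G len tent (e', 0, 1) +
         of_bool (head G e' = w) * slope G len tent (e', len e', -1)) =
      (\<Sum>e'\<in>{e}. of_bool (tail G e' = w) * slope G len tent (e', 0, 1) +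
         of_bool (head G e' = w) * slope G len tent (e', len e', -1))"
      by (rule sum.mono_neutral_right) (use e sl0 in auto)
    then show ?thesis by (simp add: net_current_Vertex sl)
  qed
  moreover have "net_current tent (Inner e' s) = of_bool (Inner e' s = x)"
    if "e' \<in> arcs G" "0 < s" "s < len e'" for e' s
  proof -
    consider "e' \<noteq> e" | "e' = e" "s < t" | "e' = e" "s = t" | "e' = e" "t < s" by force
    then show ?thesis
      using that by cases (auto simp: net_current_Inner Inner sl sl0 sl1 sl2 l_def)
  qed
  ultimately have tent: "has_net_current tent (\<lambda>y. of_bool (y = x) -
      (1 - t / l) * of_bool (y = Vertex (tail G e)) - t / l * of_bool (y = Vertex (head G e)))"
    using Inner by (auto simp: has_net_current_def points_def)
  obtain f\<^sub>0 where f\<^sub>0: "has_net_current f\<^sub>0 (\<lambda>y. of_bool (y = Vertex (tail G e)) - of_bool (y = Vertex v))"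
    using vertex_current_exists[of "tail G e" v] assms(2) e by auto
  obtain f\<^sub>1 where f\<^sub>1: "has_net_current f\<^sub>1 (\<lambda>y. of_bool (y = Vertex (head G e)) - of_bool (y = Vertex v))"
    using vertex_current_exists[of "head G e" v] assms(2) e by auto
  note F = has_net_current_lincomb[OF tent has_net_current_lincomb[OF f\<^sub>0 f\<^sub>1, of "1 - t / l" "t / l"], of 1 1]
  show thesis
    by (rule that, rule back_subst[of "has_net_current _", OF F]) (simp add: fun_eq_iff algebra_simps)
qed

section \<open>Regrouping edge contributions by points\<close>

text \<open>Double counting of the directions based at vertices and breakpoints. Grouped by edge
  they give the boundary terms; grouped by base point \<open>x\<close> they share the factor
  \<open>\<Phi> (f x)\<close> and give the net current.\<close>

lemma sum_boundary_sum:
  fixes f :: "('v, 'e) gpoint \<Rightarrow> real"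
  assumes S: "\<And>e. e \<in> arcs G \<Longrightarrow> finite (S e)"
  defines "N \<equiv> Vertex ` verts G \<union> {Inner e t | e t. e \<in> arcs G \<and> t \<in> S e \<inter> {0<..<len e}}"
  shows "finite N"
    and "(\<Sum>e\<in>arcs G. boundary_sum \<Phi> (\<lambda>t. f (edge_point G len e t)) (S e) 0 (len e)) =
      (\<Sum>x\<in>N. \<Phi> (f x) * net_current f x)"
proof -
  define T where "T e = S e \<inter> {0<..<len e}" for e
  have T: "finite (T e)" "0 \<notin> T e" "len e \<notin> T e" if "e \<in> arcs G" for e
    using S[OF that] by (auto simp: T_def)
  have "N = Vertex ` verts G \<union> (\<Union>e\<in>arcs G. Inner e ` T e)" by (auto simp: N_def T_def)
  then show N: "finite N" using T by simp
  \<comment> \<open>Along \<open>e\<close>, the parameter \<open>0\<close> has only the direction to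
    the head and \<open>len e\<close> only the one to the tail; breakpoints inside have
    both.\<close>
  define D where "D e = (\<lambda>t. (e, t, 1::real)) ` insert 0 (T e) \<union> (\<lambda>t. (e, t, -1)) ` insert (len e) (T e)" for e
  define w where "w d = (case d of (e, t, s) \<Rightarrow> \<Phi> (f (edge_point G len e t)) * - slope G len f d)"
    for d :: "'e \<times> real \<times> real"
  have D: "finite (D e)" if "e \<in> arcs G" for e using T[OF that] by (simp add: D_def)
  have dir_N: "(\<Union>x\<in>N. directions G len x) = (\<Union>e\<in>arcs G. D e)"
  proof (intro equalityI subsetI)
    fix d assume "d \<in> (\<Union>x\<in>N. directions G len x)"
    then obtain x where x: "x \<in> N" "d \<in> directions G len x" by blast
    from x(1) consider v where "x = Vertex v"
      | e t where "x = Inner e t" "e \<in> arcs G" "t \<in> T e"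
      by (auto simp: N_def T_def)
    then show "d \<in> (\<Union>e\<in>arcs G. D e)"
    proof cases
      case 1
      then show ?thesis using x(2) by (auto simp: directions_Vertex D_def)
    next
      case (2 e t)
      then have "d \<in> D e" using x(2) by (auto simp: T_def D_def directions_Inner)
      then show ?thesis using 2 by blast
    qed
  next
    fix d assume "d \<in> (\<Union>e\<in>arcs G. D e)"
    then obtain e where e: "e \<in> arcs G" "d \<in> D e" by blast
    have "Vertex (tail G e) \<in> N" "Vertex (head G e) \<in> N" using e(1) by (auto simp: N_def)
    moreover have "(e, 0, 1) \<in> directions G len (Vertex (tail G e))"
      "(e, len e, -1) \<in> directions G len (Vertex (head G e))"
      using e(1) by (auto simp: directions_Vertex)
    moreover have "Inner e t \<in> N \<and> (e, t, 1) \<in> directions G len (Inner e t) \<and>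
        (e, t, -1) \<in> directions G len (Inner e t)" if "t \<in> T e" for t
      using that e(1) by (auto simp: N_def T_def directions_Inner)
    ultimately show "d \<in> (\<Union>x\<in>N. directions G len x)"
      using e(2) unfolding D_def by blast
  qed
  have fin: "finite (directions G len x)" if "x \<in> N" for x
  proof -
    have "directions G len x \<subseteq> (\<Union>e\<in>arcs G. D e)" using that dir_N by blast
    then show ?thesis using D by (simp add: finite_subset)
  qed
  have edge: "boundary_sum \<Phi> (\<lambda>t. f (edge_point G len e t)) (S e) 0 (len e) = (\<Sum>d\<in>D e. w d)"
    if "e \<in> arcs G" for e
  proof -
    have "(\<Sum>d\<in>D e. w d) = (\<Sum>t\<in>insert 0 (T e). w (e, t, 1)) + (\<Sum>t\<in>insert (len e) (T e). w (e, t, -1))"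
    proof -
      have "inj_on (\<lambda>t. (e, t, s)) A" for s :: real and A :: "real set" by (simp add: inj_on_def)
      note reindex = sum.reindex[OF this, unfolded comp_def]
      show ?thesis unfolding D_def using T[OF that]
        by (subst sum.union_disjoint) (auto simp: reindex simp del: image_insert)
    qed
    then show ?thesis using T[OF that]
      by (simp add: boundary_sum_def w_def slope_eq T_def[symmetric] sum.distrib sum_negf algebra_simps)
  qed
  have "(\<Sum>x\<in>N. \<Phi> (f x) * net_current f x) = (\<Sum>x\<in>N. \<Sum>d\<in>directions G len x. w d)"
    unfolding net_current_def sum_distrib_left
    by (intro sum.cong refl) (auto simp: w_def directions_def)
  also have "\<dots> = (\<Sum>d\<in>(\<Union>x\<in>N. directions G len x). w d)"
    by (rule sum.UNION_disjoint[symmetric]) (use N fin in \<open>auto simp: directions_def\<close>)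
  also have "\<dots> = (\<Sum>e\<in>arcs G. \<Sum>d\<in>D e. w d)"
    unfolding dir_N by (rule sum.UNION_disjoint) (use D in \<open>auto simp: D_def\<close>)
  finally show "(\<Sum>e\<in>arcs G. boundary_sum \<Phi> (\<lambda>t. f (edge_point G len e t)) (S e) 0 (len e)) =
      (\<Sum>x\<in>N. \<Phi> (f x) * net_current f x)"
    using edge by simp
qed

text \<open>In the regrouped sum Kirchhoff's law cancels every point other than \<open>y\<close> and
  \<open>z\<close>.\<close>

lemma unit_current_boundary_sum:
  assumes f: "unit_current_potential G len y z f" and yz: "y \<in> points G len" "z \<in> points G len"
  obtains S where
    "\<And>e. e \<in> arcs G \<Longrightarrow> affine_off (\<lambda>t. f (edge_point G len e t)) (S e) (len e)"
    "\<And>\<Phi>. (\<Sum>e\<in>arcs G. boundary_sum \<Phi> (\<lambda>t. f (edge_point G len e t)) (S e) 0 (len e)) =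
       \<Phi> (f y) - \<Phi> (f z)"
proof -
  have net: "net_current f x = of_bool (x = y) - of_bool (x = z)" if "x \<in> points G len" for x
    using f that by (simp add: unit_current_potential_iff has_net_current_def)
  obtain S\<^sub>0 where S\<^sub>0: "\<forall>e\<in>arcs G. affine_off (\<lambda>t. f (edge_point G len e t)) (S\<^sub>0 e) (len e)"
    using f bchoice[of "arcs G" "\<lambda>e S. affine_off (\<lambda>t. f (edge_point G len e t)) S (len e)"]
    by (auto simp: unit_current_potential_def piecewise_affine_iff)
  \<comment> \<open>Kirchhoff's law is only summed over breakpoints, so \<open>y\<close> and \<open>z\<close> must be among them.\<close>
  define S where "S e = S\<^sub>0 e \<union> {t. Inner e t \<in> {y, z}}" for e
  have fin: "finite (S e)" if "e \<in> arcs G" for e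
  proof -
    have "finite (Inner e -` {y, z})" by (intro finite_vimageI) (auto simp: inj_on_def)
    then show ?thesis using S\<^sub>0 that by (auto simp: S_def affine_off_def vimage_def)
  qed
  define N where "N = Vertex ` verts G \<union> {Inner e t | e t. e \<in> arcs G \<and> t \<in> S e \<inter> {0<..<len e}}"
  have N: "finite N" "N \<subseteq> points G len" "y \<in> N" "z \<in> N"
    using sum_boundary_sum(1)[of S] fin yz by (auto simp: N_def points_def S_def)
  have "(\<Sum>e\<in>arcs G. boundary_sum \<Phi> (\<lambda>t. f (edge_point G len e t)) (S e) 0 (len e)) =
       \<Phi> (f y) - \<Phi> (f z)" for \<Phi>
  proof -
    have "(\<Sum>e\<in>arcs G. boundary_sum \<Phi> (\<lambda>t. f (edge_point G len e t)) (S e) 0 (len e)) =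
        (\<Sum>x\<in>N. \<Phi> (f x) * net_current f x)"
      unfolding N_def by (rule sum_boundary_sum(2)) (rule fin)
    also have "\<dots> = (\<Sum>x\<in>N. \<Phi> (f x) * of_bool (x = y)) - (\<Sum>x\<in>N. \<Phi> (f x) * of_bool (x = z))"
      unfolding sum_subtractf[symmetric]
      by (rule sum.cong) (use N net in \<open>auto simp: right_diff_distrib\<close>)
    also have "(\<Sum>x\<in>N. \<Phi> (f x) * of_bool (x = u)) = \<Phi> (f u)" if "u \<in> N" for u
      using that N(1) by (subst sum.mono_neutral_right[of _ "{u}"]) auto
    ultimately show ?thesis using N by simp
  qed
  moreover have "affine_off (\<lambda>t. f (edge_point G len e t)) (S e) (len e)" if "e \<in> arcs G" for e
    using affine_off_mono[OF _ fin[OF that]] S\<^sub>0 that by (auto simp: S_def)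
  ultimately show thesis using that by blast
qed

section \<open>Nonnegativity and uniqueness\<close>

text \<open>The edge contributions are nonnegative with total
  \<open>\<Phi> (f y) - \<Phi> (f z)\<close>, which is at most 0, so each vanishes. Then
  \<open>\<Phi> \<circ> f\<close> is constant on every edge, and connectedness makes it constant
  overall.\<close>

lemma unit_current_mono_constant:
  fixes \<Phi> :: "real \<Rightarrow> real"
  assumes f: "unit_current_potential G len y z f" "y \<in> points G len" "z \<in> points G len"
    and \<Phi>: "mono \<Phi>" "\<Phi> (f y) \<le> \<Phi> (f z)" and "x \<in> points G len"
  shows "\<Phi> (f x) = \<Phi> (f z)"
proof -
  obtain S where S: "\<And>e. e \<in> arcs G \<Longrightarrow> affine_off (\<lambda>t. f (edge_point G len e t)) (S e) (len e)"
    and sum: "\<And>\<Phi>. (\<Sum>e\<in>arcs G. boundary_sum \<Phi> (\<lambda>t. f (edge_point G len e t)) (S e) 0 (len e)) =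
       \<Phi> (f y) - \<Phi> (f z)"
    by (rule unit_current_boundary_sum[OF f], rule that)
  let ?B = "\<lambda>e. boundary_sum \<Phi> (\<lambda>t. f (edge_point G len e t)) (S e) 0 (len e)"
  have *: "0 \<le> ?B e \<and> (?B e = 0 \<longrightarrow>
      (\<forall>t\<in>{0..len e}. \<Phi> (f (edge_point G len e t)) = \<Phi> (f (edge_point G len e 0))))"
    if "e \<in> arcs G" for e
    by (rule boundary_sum_mono[OF S[OF that] _ _ _ \<Phi>(1)]) (use len_pos[OF that] in auto)
  have "(\<Sum>e\<in>arcs G. ?B e) \<le> 0" using sum[of \<Phi>] \<Phi>(2) by simp
  moreover have "(\<Sum>e\<in>arcs G. ?B e) \<ge> 0" by (rule sum_nonneg) (use * in blast)
  ultimately have "(\<Sum>e\<in>arcs G. ?B e) = 0" by simp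
  then have "\<forall>e\<in>arcs G. ?B e = 0"
    by (subst (asm) sum_nonneg_eq_0_iff) (use * in auto)
  then have edge: "\<Phi> (f (edge_point G len e t)) = \<Phi> (f (Vertex (tail G e)))"
    if "e \<in> arcs G" "0 \<le> t" "t \<le> len e" for e t
    using *[OF that(1)] that by (auto simp: edge_point_simps)
  have "\<Phi> (f (Vertex (tail G e))) = \<Phi> (f (Vertex (head G e)))" if "e \<in> arcs G" for e
    using edge[OF that, of "len e"] len_pos[OF that] by (simp add: edge_point_simps that)
  then have verts: "\<Phi> (f (Vertex u)) = \<Phi> (f (Vertex v))" if "u \<in> verts G" "v \<in> verts G" for u v
    using constant_along_arcs_imp_constant[of "\<lambda>v. \<Phi> (f (Vertex v))"] that by blast
  have "\<exists>v\<in>verts G. \<Phi> (f x) = \<Phi> (f (Vertex v))" if "x \<in> points G len" for x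
  proof (cases x)
    case (Vertex v)
    then show ?thesis using that by (auto simp: points_def)
  next
    case (Inner e t)
    then have "e \<in> arcs G" "0 < t" "t < len e" using that by (auto simp: points_def)
    then show ?thesis using edge[of e t] Inner by (auto simp: edge_point_simps intro!: bexI[of _ "tail G e"])
  qed
  then show ?thesis using verts assms(3,6) by metis
qed

lemma unit_current_nonneg:
  assumes "unit_current_potential G len y z f" "y \<in> points G len" "z \<in> points G len" "f z = 0"
    and "x \<in> points G len"
  shows "0 \<le> f x"
proof -
  \<comment> \<open>The inequality between the values at \<open>y\<close> and \<open>z\<close> holds
    because \<open>min (f y) 0\<close> is at most 0 while \<open>f z = 0\<close>.\<close>
  have "min (f x) 0 = min (f z) 0"
    by (rule unit_current_mono_constant[OF assms(1-3), of "\<lambda>r. min r 0"])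
      (use assms in \<open>auto simp: mono_def min_def\<close>)
  then show ?thesis using assms(4) by simp
qed

lemma unit_current_unique:
  assumes "unit_current_potential G len y z f" "unit_current_potential G len y z f'"
    and "y \<in> points G len" "z \<in> points G len" "f z = 0" "f' z = 0" and "x \<in> points G len"
  shows "f x = f' x"
proof -
  \<comment> \<open>The sources cancel, which is the case of coinciding entry and exit; the
    inequality needed for constancy is then trivial.\<close>
  have "unit_current_potential G len z z (\<lambda>x. 1 * f x + (-1) * f' x)"
    using has_net_current_lincomb[of f _ f' _ 1 "-1"] assms(1,2)
    unfolding unit_current_potential_iff by force
  from unit_current_mono_constant[OF this assms(4,4), of "\<lambda>r. r" x] show ?thesis
    using assms by (simp add: mono_def)
qed

lemma unit_current_exists:
  assumes "y \<in> points G len" "z \<in> points G len"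
  obtains f where "unit_current_potential G len y z f"
proof -
  obtain v where v: "v \<in> verts G"
    using connected_graph by (auto simp: connected_def strongly_connected_def)
  \<comment> \<open>Both currents are led to the auxiliary vertex \<open>v\<close>, where they
    cancel in the difference.\<close>
  obtain f where f: "has_net_current f (\<lambda>x. of_bool (x = y) - of_bool (x = Vertex v))"
    by (rule point_current_exists[OF assms(1) v], rule that)
  obtain f' where f': "has_net_current f' (\<lambda>x. of_bool (x = z) - of_bool (x = Vertex v))"
    by (rule point_current_exists[OF assms(2) v], rule that)
  note F = has_net_current_lincomb[OF f f', of 1 "-1"]
  show thesis
    by (rule that, unfold unit_current_potential_iff, rule back_subst[of "has_net_current _", OF F])
      (simp add: fun_eq_iff)
qed

section \<open>The normalized potential, effective resistance and the integral\<close>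

text \<open>Justifies the definite description: a potential shifted to vanish at \<open>z\<close>
  and restricted to the graph exists, and \<open>unit_current_unique\<close> leaves no
  other.\<close>

lemma potential_j:
  assumes "y \<in> points G len" "z \<in> points G len"
  shows "unit_current_potential G len y z (\<lambda>x. potential_j G len z x y)"
    and "potential_j G len z z y = 0"
proof -
  let ?P = "\<lambda>f. f \<in> extensional (points G len) \<and> unit_current_potential G len y z f \<and> f z = 0"
  obtain f where f: "unit_current_potential G len y z f" using unit_current_exists[OF assms] .
  have "has_net_current (\<lambda>x. 1 * f x + 1 * - f z) (\<lambda>x. of_bool (x = y) - of_bool (x = z))"
    using has_net_current_lincomb[OF f[unfolded unit_current_potential_iff] has_net_current_const[of "- f z"], of 1 1]
    by simp
  then have "unit_current_potential G len y z (restrict (\<lambda>x. 1 * f x + 1 * - f z) (points G len))"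
    unfolding unit_current_potential_iff by (rule has_net_current_cong) simp
  then have P: "?P (restrict (\<lambda>x. 1 * f x + 1 * - f z) (points G len))" using assms by simp
  have unique: "f = f'" if "?P f" "?P f'" for f f'
    by (rule extensionalityI[of f "points G len"]) (use that unit_current_unique assms in blast)+
  have "?P (THE f. ?P f)" by (rule theI[of ?P, OF P], rule unique[OF _ P])
  then show "unit_current_potential G len y z (\<lambda>x. potential_j G len z x y)"
    and "potential_j G len z z y = 0"
    by (simp_all add: potential_j_def)
qed

lemma eff_resistance_eq:
  assumes "p \<in> points G len" "q \<in> points G len"
  shows "eff_resistance G len p q = potential_j G len p q q"
proof -
  let ?j = "\<lambda>x. potential_j G len p x q"
  \<comment> \<open>Negation reverses the current, and the constant \<open>?j q\<close> restores the
    value 0 at \<open>q\<close>. At \<open>p\<close> the result equals \<open>?j q\<close>, since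
    \<open>?j p = 0\<close>.\<close>
  note F = has_net_current_lincomb[OF has_net_current_const[of "?j q"]
      potential_j(1)[OF assms(2,1), unfolded unit_current_potential_iff], of 1 "-1"]
  have "unit_current_potential G len p q (\<lambda>x. 1 * ?j q + (-1) * ?j x)"
    unfolding unit_current_potential_iff
    by (rule back_subst[of "has_net_current _", OF F]) (simp add: fun_eq_iff)
  from unit_current_unique[OF potential_j(1)[OF assms] this assms potential_j(2)[OF assms] _ assms(1)]
  have "potential_j G len q p p = ?j q - ?j p" by simp
  then show ?thesis
    using potential_j(2)[OF assms] potential_j(2)[OF assms(2,1)] by (simp add: eff_resistance_def)
qed

lemma integral_deriv_square_power:
  fixes n :: real
  assumes "p \<in> points G len" "q \<in> points G len" and n: "n > -1"
  defines "j \<equiv> \<lambda>x. potential_j G len p x q"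
  defines "F \<equiv> \<lambda>x. (edge_deriv G len j x)\<^sup>2 * j x powr n"
  shows "graph_integrable G len F"
    and "graph_integral G len F = 1 / (n + 1) * eff_resistance G len p q powr (n + 1)"
proof -
  define \<Phi> where "\<Phi> = (\<lambda>y. y powr (n + 1) / (n + 1))"
  have j: "unit_current_potential G len q p j" "j p = 0"
    unfolding j_def using potential_j assms(1,2) by blast+
  obtain S where S: "\<And>e. e \<in> arcs G \<Longrightarrow> affine_off (\<lambda>t. j (edge_point G len e t)) (S e) (len e)"
    and sum: "\<And>\<Phi>. (\<Sum>e\<in>arcs G. boundary_sum \<Phi> (\<lambda>t. j (edge_point G len e t)) (S e) 0 (len e)) =
       \<Phi> (j q) - \<Phi> (j p)"
    by (rule unit_current_boundary_sum[OF j(1) assms(2,1)], rule that)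
  have *: "has_bochner_integral lborel (\<lambda>t. indicator {0..len e} t *\<^sub>R F (edge_point G len e t))
      (boundary_sum \<Phi> (\<lambda>t. j (edge_point G len e t)) (S e) 0 (len e))" if e: "e \<in> arcs G" for e
    unfolding F_def \<Phi>_def
  proof (rule power_integral_eq_boundary_sum[OF S[OF e]])
    show "0 \<le> j (edge_point G len e t)" if "0 \<le> t" "t \<le> len e" for t
      using unit_current_nonneg[OF j(1) assms(2,1) j(2)] edge_point_in_points e that by blast
  qed (use len_pos[OF e] n in \<open>auto simp: edge_point_simps\<close>)
  then show "graph_integrable G len F"
    by (auto simp: graph_integrable_def set_integrable_def has_bochner_integral_iff)
  have "graph_integral G len F = \<Phi> (j q) - \<Phi> (j p)"
    unfolding graph_integral_def set_lebesgue_integral_def sum[symmetric]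
    by (intro sum.cong refl) (use * in \<open>simp add: has_bochner_integral_iff\<close>)
  \<comment> \<open>The term at \<open>p\<close> drops out because \<open>0 powr (n + 1)\<close> is
    0.\<close>
  then show "graph_integral G len F = 1 / (n + 1) * eff_resistance G len p q powr (n + 1)"
    using j(2) n by (simp add: \<Phi>_def eff_resistance_eq[OF assms(1,2)] j_def)
qed

end

theorem theorem2p18:
  fixes G :: "('v, 'e) pre_digraph" and len :: "'e \<Rightarrow> real"
    and p q :: "('v, 'e) gpoint" and n :: real
  assumes "metrized_graph G len"
    and "p \<in> points G len" and "q \<in> points G len"
    and "n > -1"
  defines "j \<equiv> \<lambda>x. potential_j G len p x q"
  shows "graph_integrable G len (\<lambda>x. (edge_deriv G len j x)\<^sup>2 * j x powr n) \<and>
    graph_integral G len (\<lambda>x. (edge_deriv G len j x)\<^sup>2 * j x powr n) =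
      1 / (n + 1) * eff_resistance G len p q powr (n + 1)"
  unfolding j_def using metrized_graph.integral_deriv_square_power[OF assms(1-4)] by blast

end
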